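(* Let $X$ be $\ell^p_{a,b}$ for some $1\le p<\infty$, or $c_{0,a,b}$. If $B_w$ is bounded on $X$, then the sequences $\left\{\frac{w_{n+1}a_{n+1}}{a_n}\right\}_{n\ge1}$ and $\{c_n\}_{n\ge1}$ are bounded, where $c_n:=w_{n+1}\frac{b_n}{a_n}-w_n\frac{b_{n-1}}{a_{n-1}}$.
   Context: $\mathbb{D}$ is the open unit disc in $\mathbb{C}$. $a=(a_n)_{n\ge0}$ and $b=(b_n)_{n\ge0}$ are complex sequences with $a_n\ne0$ for all $n$, and $f_n(z)=(a_n+b_nz)z^n$, $n\ge0$. For $1\le p<\infty$, $\ell^p_{a,b}$ is the Banach space of analytic functions on $\mathbb{D}$ of the form $f=\sum_{n\ge0}\lambda_nf_n$ with $(\lambda_n)\in\ell^p$, normed by $\|f\|=(\sum_n|\lambda_n|^p)^{1/p}$ (so $\{f_n\}$ is a normalized Schauder basis equivalent to the standard basis of $\ell^p$, and an orthonormal basis when $p=2$). $c_{0,a,b}$ is the Banach space of analytic functions $f=\sum_{n\ge0}\lambda_nf_n$ on $\mathbb{D}$ with $\lambda_n\to0$, normed by $\|f\|=\sup_n|\lambda_n|$. Standing assumption: each of the sets $\mathcal D_1=\{z\in\mathbb{C}:\sum_n((|a_n|+|b_n|)|z|^n)^q<\infty\}$ (with $1/p+1/q=1$, relevant for $1<p<\infty$), $\mathcal D_2=\{z\in\mathbb{C}:\sup_n(|a_n|+|b_n|)|z|^n<\infty\}$ (relevant for $p=1$) and $\mathcal D_3=\{z\in\mathbb{C}:\sum_n(|a_n|+|b_n|)|z|^n<\infty\}$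 (relevant for $c_{0,a,b}$) equals $\mathbb{D}$. $w=(w_n)_{n\ge0}$ is a sequence of non-zero complex numbers, and the weighted backward shift acts on Taylor series by $B_w(\sum_{n\ge0}\lambda_nz^n)=\sum_{n\ge0}w_{n+1}\lambda_{n+1}z^n$. *)

theory Defs
  imports "HOL-Complex_Analysis.Complex_Analysis"
begin

(* Sequence spaces underlying X: Ell p stands for l^p (only meant for real p >= 1, see
   valid_space), C_null for c_0. *)
datatype seq_space = Ell real | C_null

fun valid_space :: "seq_space \<Rightarrow> bool" where
  "valid_space (Ell p) \<longleftrightarrow> 1 \<le> p"
| "valid_space C_null \<longleftrightarrow> True"

fun seqs :: "seq_space \<Rightarrow> (nat \<Rightarrow> complex) set" where
  "seqs (Ell p) = {l. summable (\<lambda>n. norm (l n) powr p)}"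
| "seqs C_null = {l. l \<longlonglongrightarrow> 0}"

fun seq_norm :: "seq_space \<Rightarrow> (nat \<Rightarrow> complex) \<Rightarrow> real" where
  "seq_norm (Ell p) l = (\<Sum>n. norm (l n) powr p) powr (1 / p)"
| "seq_norm C_null l = (SUP n. norm (l n))"

definition basis_fun :: "(nat \<Rightarrow> complex) \<Rightarrow> (nat \<Rightarrow> complex) \<Rightarrow> nat \<Rightarrow> complex \<Rightarrow> complex" where
  "basis_fun a b n z = (a n + b n * z) * z ^ n"

(* The points z where (|a n| + |b n|) |z|^n lies in the dual sequence space (l^infinity for l^1,
   l^q for l^p, l^1 for c_0); p / (p - 1) is the exponent q with 1/p + 1/q = 1. *)
fun conv_domain :: "seq_space \<Rightarrow> (nat \<Rightarrow> complex) \<Rightarrow> (nat \<Rightarrow> complex) \<Rightarrow> complex set" where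
  "conv_domain (Ell p) a b =
     (if p = 1 then {z. bdd_above (range (\<lambda>n. (norm (a n) + norm (b n)) * norm z ^ n))}
      else {z. summable (\<lambda>n. ((norm (a n) + norm (b n)) * norm z ^ n) powr (p / (p - 1)))})"
| "conv_domain C_null a b = {z. summable (\<lambda>n. (norm (a n) + norm (b n)) * norm z ^ n)}"

definition represents ::
  "(nat \<Rightarrow> complex) \<Rightarrow> (nat \<Rightarrow> complex) \<Rightarrow> (nat \<Rightarrow> complex) \<Rightarrow> (complex \<Rightarrow> complex) \<Rightarrow> bool" where
  "represents a b l f \<longleftrightarrow> (\<forall>z\<in>ball 0 1. (\<lambda>n. l n * basis_fun a b n z) sums f z)"

(* A function on the unit disc is modelled by a total function whose values outside the disc
   are irrelevant to all notions below. *)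
definition fun_space ::
  "seq_space \<Rightarrow> (nat \<Rightarrow> complex) \<Rightarrow> (nat \<Rightarrow> complex) \<Rightarrow> (complex \<Rightarrow> complex) set" where
  "fun_space S a b = {f. f holomorphic_on ball 0 1 \<and> (\<exists>l\<in>seqs S. represents a b l f)}"

(* If all a n are nonzero and conv_domain S a b is the unit disc, the coefficient sequence of
   f is unique: the n-th Taylor coefficient of f is l n * a n + l (n - 1) * b (n - 1). *)
definition fun_norm ::
  "seq_space \<Rightarrow> (nat \<Rightarrow> complex) \<Rightarrow> (nat \<Rightarrow> complex) \<Rightarrow> (complex \<Rightarrow> complex) \<Rightarrow> real" where
  "fun_norm S a b f = seq_norm S (THE l. l \<in> seqs S \<and> represents a b l f)"

definition backward_shift :: "(nat \<Rightarrow> complex) \<Rightarrow> complex fps \<Rightarrow> complex fps" where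
  "backward_shift w F = Abs_fps (\<lambda>n. w (n + 1) * fps_nth F (n + 1))"

(* B_w is only defined on Taylor series, so "B_w f lies in X" means that the shifted Taylor
   series of f is the Taylor series at 0 of some g in X (unique on the disc). *)
definition shift_bounded ::
  "(nat \<Rightarrow> complex) \<Rightarrow> seq_space \<Rightarrow> (nat \<Rightarrow> complex) \<Rightarrow> (nat \<Rightarrow> complex) \<Rightarrow> bool" where
  "shift_bounded w S a b \<longleftrightarrow>
     (\<exists>C. \<forall>f\<in>fun_space S a b. \<exists>g\<in>fun_space S a b.
        fps_expansion g 0 = backward_shift w (fps_expansion f 0) \<and>
        fun_norm S a b g \<le> C * fun_norm S a b f)"

end

(* Proof idea: comparing Taylor coefficients shows that the coefficient sequence of a function in X
   is unique, and that B_w f_n = (w_n a_n / a_(n-1)) f_(n-1) + c_n f_n + ....  As f_n has norm 1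
   and every coefficient is bounded by the norm, both displayed coefficients are bounded by the
   operator norm of B_w. *)
theory Submission
  imports Defs
begin

text \<open>A single term of a series of nonnegative reals is at most its sum. For
  \<open>C_null\<close>, a convergent sequence is bounded, so \<open>SUP\<close> is a genuine least
  upper bound. This makes every coefficient functional on X a contraction.\<close>

lemma norm_nth_le_seq_norm:
  assumes "valid_space S" and "l \<in> seqs S"
  shows "norm (l n) \<le> seq_norm S l"
proof (cases S)
  case (Ell p)
  with assms have p: "1 \<le> p" and summ: "summable (\<lambda>n. norm (l n) powr p)"
    by auto
  have "norm (l n) powr p \<le> (\<Sum>n. norm (l n) powr p)"
    using sum_le_suminf[OF summ, of "{n}"] by simp
  hence "(norm (l n) powr p) powr (1 / p) \<le> (\<Sum>n. norm (l n) powr p) powr (1 / p)"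
    using p by (intro powr_mono2) auto
  thus ?thesis
    using p Ell by (simp add: powr_powr)
next
  case C_null
  with assms have "convergent l"
    by (auto simp: convergent_def)
  hence "bdd_above (range (\<lambda>n. norm (l n)))"
    by (metis Bseq_eq_bounded bdd_above_norm convergent_imp_Bseq image_image)
  thus ?thesis
    using C_null by (auto intro: cSUP_upper)
qed

text \<open>The three cases of \<open>conv_domain\<close> ask for membership in l^infinity, l^q or
  l^1, and all of these consist of bounded sequences.\<close>

lemma conv_domain_bounded:
  assumes S: "valid_space S" and z: "z \<in> conv_domain S a b"
  obtains M where "\<And>n. (norm (a n) + norm (b n)) * norm z ^ n \<le> M"
proof -
  define l where "l n = complex_of_real ((norm (a n) + norm (b n)) * norm z ^ n)" for n
  have norm_l: "norm (l n) = (norm (a n) + norm (b n)) * norm z ^ n" for n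
    unfolding l_def norm_of_real by simp
  \<comment> \<open>The first alternative covers \<open>Ell 1\<close>. The second takes
    \<open>q\<close> to be the conjugate exponent for \<open>p > 1\<close>, and 1 for
    \<open>C_null\<close>; the preceding lemma then bounds \<open>l\<close> by its l^q norm.\<close>
  have "(\<exists>M. \<forall>n. norm (l n) \<le> M) \<or> (\<exists>q\<ge>1. l \<in> seqs (Ell q))"
  proof (cases S)
    case (Ell p)
    show ?thesis
    proof (cases "p = 1")
      case True
      thus ?thesis
        using z Ell by (auto simp: bdd_above_def norm_l)
    next
      case False
      hence "p / (p - 1) \<ge> 1"
        using S Ell by (auto simp: field_simps)
      moreover have "l \<in> seqs (Ell (p / (p - 1)))"
        using z Ell False by (simp add: norm_l)
      ultimately show ?thesis
        by blast
    qed
  next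
    case C_null
    hence "l \<in> seqs (Ell 1)"
      using z by (simp add: norm_l)
    thus ?thesis
      by (intro disjI2 exI[of _ 1]) auto
  qed
  hence "\<exists>M. \<forall>n. norm (l n) \<le> M"
    by (metis norm_nth_le_seq_norm valid_space.simps(1))
  thus ?thesis
    using that norm_l by auto
qed

text \<open>Near 0 the representing series splits into two separately convergent power series, one
  built from \<open>a\<close> and one from \<open>b\<close>; the factor \<open>z\<close> in
  \<open>b n * z\<close> becomes \<open>fps_X\<close>.\<close>

lemma fps_expansion_represents:
  assumes S: "valid_space S" and dom: "conv_domain S a b = ball 0 1"
    and l: "l \<in> seqs S" and rep: "represents a b l f"
  shows "fps_expansion f 0 = Abs_fps (\<lambda>n. l n * a n) + fps_X * Abs_fps (\<lambda>n. l n * b n)"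
proof (intro fps_expansion_eqI has_fps_expansionI)
  \<comment> \<open>Any nonzero point of the disc would serve. Boundedness at 1/2 gives absolute
    convergence for \<open>norm z < 1 / 2\<close> by Abel's lemma, which is enough for an expansion
    at 0.\<close>
  have "1 / 2 \<in> conv_domain S a b"
    unfolding dom by (simp add: norm_divide)
  then obtain M where M: "\<And>n. (norm (a n) + norm (b n)) * norm (1 / 2 :: complex) ^ n \<le> M"
    using conv_domain_bounded[OF S] by blast
  \<comment> \<open>Here \<open>c\<close> stands for either \<open>a\<close> or
    \<open>b\<close>.\<close>
  have coeff_bound: "norm (l n * c n) * (1 / 2) ^ n \<le> seq_norm S l * M"
    if c: "\<And>n. norm (c n) \<le> norm (a n) + norm (b n)" for n and c :: "nat \<Rightarrow> complex"
  proof -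
    have "norm (c n) * (1 / 2) ^ n \<le> (norm (a n) + norm (b n)) * (1 / 2) ^ n"
      by (intro mult_right_mono c) auto
    also have "\<dots> \<le> M"
      using M[of n] by (simp add: norm_divide)
    finally have "norm (l n) * (norm (c n) * (1 / 2) ^ n) \<le> seq_norm S l * M"
      by (intro mult_mono' norm_nth_le_seq_norm[OF S l]) auto
    thus ?thesis
      by (simp add: norm_mult mult.assoc)
  qed
  have summ: "summable (\<lambda>n. l n * c n * z ^ n)"
    if c: "\<And>n. norm (c n) \<le> norm (a n) + norm (b n)" and z: "norm z < 1 / 2"
    for c :: "nat \<Rightarrow> complex" and z
  proof (rule summable_norm_cancel)
    show "summable (\<lambda>n. norm (l n * c n * z ^ n))"
      using Abel_lemma[OF norm_ge_zero z, of "\<lambda>n. l n * c n", OF coeff_bound[OF c]]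
      by (simp add: norm_mult norm_power)
  qed
  have "(\<lambda>n. fps_nth (Abs_fps (\<lambda>n. l n * a n) + fps_X * Abs_fps (\<lambda>n. l n * b n)) n * z ^ n) sums f z"
    if z: "norm z < 1 / 2" for z
  proof -
    obtain s where s: "(\<lambda>n. l n * a n * z ^ n) sums s"
      using summ[OF _ z, of a] by (auto simp: summable_def)
    obtain t where t: "(\<lambda>n. l n * b n * z ^ n) sums t"
      using summ[OF _ z, of b] by (auto simp: summable_def)
    have "(\<lambda>n. l n * a n * z ^ n + z * (l n * b n * z ^ n)) sums (s + z * t)"
      by (intro sums_add sums_mult s t)
    moreover have "(\<lambda>n. l n * a n * z ^ n + z * (l n * b n * z ^ n)) sums f z"
      using rep z by (auto simp: represents_def basis_fun_def algebra_simps)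
    ultimately have f: "f z = s + z * t"
      by (rule sums_unique2[symmetric])
    \<comment> \<open>Multiplication by \<open>fps_X\<close> puts a zero coefficient in front, so
      \<open>sums_Suc\<close> accounts for the index shift.\<close>
    have "(\<lambda>n. fps_nth (fps_X * Abs_fps (\<lambda>n. l n * b n)) n * z ^ n) sums (z * t)"
      using sums_mult[OF t, of z]
        sums_Suc[of "\<lambda>n. fps_nth (fps_X * Abs_fps (\<lambda>n. l n * b n)) n * z ^ n" "z * t"]
      by (simp add: mult_ac)
    from sums_add[OF s this] show ?thesis
      unfolding f by (simp add: algebra_simps)
  qed
  moreover have "eventually (\<lambda>z. norm z < 1 / 2) (nhds (0 :: complex))"
    by (auto simp: eventually_nhds_metric dist_norm intro!: exI[of _ "1 / 2"])
  ultimately show "\<forall>\<^sub>F z in nhds 0.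
      (\<lambda>n. fps_nth (Abs_fps (\<lambda>n. l n * a n) + fps_X * Abs_fps (\<lambda>n. l n * b n)) n * z ^ n) sums f z"
    by (auto elim: eventually_mono)
qed

text \<open>The Taylor coefficients depend on \<open>l\<close> through a lower bidiagonal matrix
  with the nonzero \<open>a n\<close> on the diagonal, so they determine \<open>l\<close>
  recursively.\<close>

lemma represents_unique:
  assumes "valid_space S" and a: "\<And>n. a n \<noteq> 0" and "conv_domain S a b = ball 0 1"
    and "l \<in> seqs S" "represents a b l f" and "m \<in> seqs S" "represents a b m f"
  shows "l = m"
proof
  fix n
  have eq: "Abs_fps (\<lambda>n. l n * a n) + fps_X * Abs_fps (\<lambda>n. l n * b n)
      = Abs_fps (\<lambda>n. m n * a n) + fps_X * Abs_fps (\<lambda>n. m n * b n)"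
    using assms fps_expansion_represents by metis
  show "l n = m n"
  proof (induction n)
    case 0
    show ?case
      using arg_cong[OF eq, of "\<lambda>F. fps_nth F 0"] a by simp
  next
    case (Suc n)
    thus ?case
      using arg_cong[OF eq, of "\<lambda>F. fps_nth F (Suc n)"] a by simp
  qed
qed

lemma fun_norm_eq_seq_norm:
  assumes "valid_space S" and "\<And>n. a n \<noteq> 0" and "conv_domain S a b = ball 0 1"
    and "l \<in> seqs S" and "represents a b l f"
  shows "fun_norm S a b f = seq_norm S l"
proof -
  have "(THE l. l \<in> seqs S \<and> represents a b l f) = l"
    using assms by (blast intro: the_equality represents_unique)
  thus ?thesis
    by (simp add: fun_norm_def)
qed

text \<open>The coefficient sequence of the basis function f_n, used to test the boundedness of the
  shift.\<close>

definition unit_seq :: "nat \<Rightarrow> nat \<Rightarrow> complex" where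
  "unit_seq n = (\<lambda>k. if k = n then 1 else 0)"

lemma norm_unit_seq_powr: "norm (unit_seq n k) powr p = (if k = n then 1 else 0)"
  by (simp add: unit_seq_def)

lemma unit_seq_in_seqs: "unit_seq n \<in> seqs S"
proof (cases S)
  case (Ell p)
  thus ?thesis
    by (simp add: norm_unit_seq_powr)
next
  case C_null
  have "unit_seq n \<longlonglongrightarrow> 0"
    \<comment> \<open>A series with one nonzero term converges, so its terms tend to 0.\<close>
    unfolding unit_seq_def using summable_single[of n "\<lambda>_. 1"] by (rule summable_LIMSEQ_zero)
  thus ?thesis
    using C_null by simp
qed

lemma seq_norm_unit_seq: "seq_norm S (unit_seq n) = 1"
proof (cases S)
  case (Ell p)
  have "(\<Sum>k. if k = n then 1 else 0 :: real) = 1"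
    using sums_single[of n "\<lambda>_. 1 :: real"] by (simp add: sums_iff)
  thus ?thesis
    using Ell by (simp add: norm_unit_seq_powr)
next
  case C_null
  have "range (\<lambda>k. norm (unit_seq n k)) \<subseteq> {0, 1}" "1 \<in> range (\<lambda>k. norm (unit_seq n k))"
    by (auto simp: unit_seq_def image_iff split: if_splits)
  hence "(SUP k. norm (unit_seq n k)) = 1"
    by (intro cSup_eq_maximum) auto
  thus ?thesis
    using C_null by simp
qed

lemma represents_basis_fun: "represents a b (unit_seq n) (basis_fun a b n)"
  unfolding represents_def
proof
  fix z
  show "(\<lambda>k. unit_seq n k * basis_fun a b k z) sums basis_fun a b n z"
    using sums_single[of n "\<lambda>k. basis_fun a b k z"]
    by (simp add: unit_seq_def if_distrib[of "\<lambda>x. x * _"] cong: if_cong)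
qed

lemma basis_fun_in_fun_space: "basis_fun a b n \<in> fun_space S a b"
proof -
  have "basis_fun a b n holomorphic_on ball 0 1"
    unfolding basis_fun_def[abs_def] by (intro holomorphic_intros)
  thus ?thesis
    unfolding fun_space_def using unit_seq_in_seqs represents_basis_fun by blast
qed

text \<open>The right-hand side of \<open>eq\<close> is the polynomial
  \<open>w (n+1) * a (n+1) * z^n + w (n+2) * b (n+1) * z^(n+1)\<close>, the image of f_(n+1).
  Solving the bidiagonal system upwards from degree 0 gives zeros below \<open>n\<close>, then the
  two stated values. Starting from f_(n+1) avoids truncated subtraction.\<close>

lemma backward_shift_basis_coeffs:
  fixes a b w l :: "nat \<Rightarrow> complex"
  assumes a: "\<And>n. a n \<noteq> 0"
    and eq: "Abs_fps (\<lambda>k. l k * a k) + fps_X * Abs_fps (\<lambda>k. l k * b k)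
      = backward_shift w (Abs_fps (\<lambda>k. unit_seq (Suc n) k * a k)
          + fps_X * Abs_fps (\<lambda>k. unit_seq (Suc n) k * b k))"
  shows "l n = w (Suc n) * a (Suc n) / a n"
    and "l (Suc n) = w (Suc (Suc n)) * (b (Suc n) / a (Suc n)) - w (Suc n) * (b n / a n)"
proof -
  have coeff_0: "l 0 * a 0 = (if n = 0 then w 1 * a 1 else 0)"
    using arg_cong[OF eq, of "\<lambda>F. fps_nth F 0"]
    by (auto simp: backward_shift_def unit_seq_def)
  have coeff_Suc: "l (Suc k) * a (Suc k) + l k * b k = (if Suc k = n then w (Suc n) * a (Suc n)
      else if k = n then w (Suc (Suc n)) * b (Suc n) else 0)" for k
    using arg_cong[OF eq, of "\<lambda>F. fps_nth F (Suc k)"]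
    by (auto simp: backward_shift_def unit_seq_def)
  have zero: "l k = 0" if "k < n" for k
    using that
  proof (induction k)
    case 0
    thus ?case
      using coeff_0 a by simp
  next
    case (Suc k)
    thus ?case
      using coeff_Suc[of k] a by simp
  qed
  \<comment> \<open>In degree \<open>n\<close> the \<open>b\<close> part is absent if
    \<open>n = 0\<close>, and otherwise vanishes because \<open>l (n - 1) = 0\<close>.\<close>
  have "l n * a n = w (Suc n) * a (Suc n)"
  proof (cases n)
    case 0
    thus ?thesis
      using coeff_0 by simp
  next
    case (Suc m)
    thus ?thesis
      using coeff_Suc[of m] zero[of m] by simp
  qed
  thus l_n: "l n = w (Suc n) * a (Suc n) / a n"
    using a by (simp add: field_simps)
  have "l (Suc n) * a (Suc n) = w (Suc (Suc n)) * b (Suc n) - l n * b n"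
    using coeff_Suc[of n] by (simp add: algebra_simps)
  thus "l (Suc n) = w (Suc (Suc n)) * (b (Suc n) / a (Suc n)) - w (Suc n) * (b n / a n)"
    unfolding l_n using a by (simp add: field_simps)
qed

theorem proposition3p2:
  fixes a b w :: "nat \<Rightarrow> complex" and S :: seq_space
  assumes "valid_space S"
    and "\<And>n. a n \<noteq> 0"
    and "conv_domain S a b = ball 0 1"
    and "\<And>n. w n \<noteq> 0"
    and "shift_bounded w S a b"
  shows "bounded ((\<lambda>n. w (n + 1) * a (n + 1) / a n) ` {1..})
       \<and> bounded ((\<lambda>n. w (n + 1) * (b n / a n) - w n * (b (n - 1) / a (n - 1))) ` {1..})"
proof -
  note X = assms(1-3)
  obtain C where C: "\<And>f. f \<in> fun_space S a b \<Longrightarrow> \<exists>g\<in>fun_space S a b.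
      fps_expansion g 0 = backward_shift w (fps_expansion f 0) \<and>
      fun_norm S a b g \<le> C * fun_norm S a b f"
    using assms(5) unfolding shift_bounded_def by blast
  \<comment> \<open>Both quantities are coefficients of the image of f_(n+1), which has norm 1, so
    one constant \<open>C\<close> bounds them. The second one is c_(n+1).\<close>
  have bounds: "norm (w (Suc n) * a (Suc n) / a n) \<le> C"
    "norm (w (Suc (Suc n)) * (b (Suc n) / a (Suc n)) - w (Suc n) * (b n / a n)) \<le> C" for n
  proof -
    let ?f = "basis_fun a b (Suc n)"
    obtain g where g: "g \<in> fun_space S a b"
      and shift: "fps_expansion g 0 = backward_shift w (fps_expansion ?f 0)"
      and le: "fun_norm S a b g \<le> C * fun_norm S a b ?f"
      using C[OF basis_fun_in_fun_space] by blast
    obtain l where l: "l \<in> seqs S" "represents a b l g"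
      using g by (auto simp: fun_space_def)
    note f = unit_seq_in_seqs[of "Suc n" S] represents_basis_fun[of a b "Suc n"]
    have "seq_norm S l \<le> C"
      using le by (simp add: fun_norm_eq_seq_norm[OF X l] fun_norm_eq_seq_norm[OF X f] seq_norm_unit_seq)
    hence l_le: "norm (l k) \<le> C" for k
      using norm_nth_le_seq_norm[OF X(1) l(1), of k] by linarith
    note coeffs = backward_shift_basis_coeffs[OF X(2) shift[unfolded
      fps_expansion_represents[OF X(1,3) l] fps_expansion_represents[OF X(1,3) f]]]
    show "norm (w (Suc n) * a (Suc n) / a n) \<le> C"
      using l_le[of n] unfolding coeffs(1) .
    show "norm (w (Suc (Suc n)) * (b (Suc n) / a (Suc n)) - w (Suc n) * (b n / a n)) \<le> C"
      using l_le[of "Suc n"] unfolding coeffs(2) .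
  qed
  \<comment> \<open>Reindexing c_(n+1) to c_n; as \<open>n \<ge> 1\<close>, the natural-number
    subtraction \<open>n - 1\<close> is exact.\<close>
  have "norm (w (n + 1) * (b n / a n) - w n * (b (n - 1) / a (n - 1))) \<le> C" if "n \<ge> 1" for n
    using bounds(2)[of "n - 1"] that by simp
  moreover have "norm (w (n + 1) * a (n + 1) / a n) \<le> C" for n
    using bounds(1)[of n] by simp
  ultimately show ?thesis
    unfolding bounded_iff by (intro conjI exI[of _ C]) (simp_all only: ball_simps atLeast_iff simp_thms, blast+)
qed

end
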